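(* Let $\mathbb{A}$ be a $k$-letter alphabet, $\pi=(<_D,<_A)$ a pair of distinct total orders on $\mathbb{A}$, and $T$ a discrete $k$-interval exchange transformation with pair of orders $\pi$. Then $T$ admits at most $\lfloor\frac{k+d}{2}\rfloor$ distinct trajectories, where $d=\dim\ker(\Omega)$. In particular, a discrete symmetric $k$-interval exchange transformation admits at most $\lfloor\frac{k+1}{2}\rfloor$ distinct trajectories.
   Context: $\Omega=(\Omega_{i,j})_{i,j\in\mathbb{A}}$ is the real skew-symmetric $k\times k$ matrix with $\Omega_{i,j}=+1$ if $j<_A i$ and $i<_D j$; $\Omega_{i,j}=-1$ if $j<_D i$ and $i<_A j$; $\Omega_{i,j}=0$ otherwise. A discrete $k$-interval exchange transformation with pair of orders $\pi=(<_D,<_A)$ on a $k$-letter alphabet $\mathbb{A}$ and length vector $\lambda=(\lambda_a)_{a\in\mathbb{A}}$ (nonnegative integers, with sum $m\ge1$) is the bijection $T:I\to I$ of $I=\{1,\ldots,m\}$ obtained as follows: $I$ is partitioned into $k$ intervals $I_a$ ($a\in\mathbb{A}$) of consecutive integers with $|I_a|=\lambda_a$, placed from left to right in increasing order of $a$ with respect to $<_D$; the images $T(I_a)$ are also intervals partitioning $I$, placed from left to right in increasing order of $a$ with respect to $<_A$; and the restriction of $T$ to each $I_a$ is a translation. $T$ is symmetric if $\pi$ is symmetric, i.e. $a<_D b\Leftrightarrow b<_A a$ for all $a,b\in\mathbb{A}$. The natural coding of the trajectory (orbit) of $x\in I$ is the bi-infinite word $(x_n)_{n\in\mathbb{Z}}$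 with $x_n=a$ iff $T^n(x)\in I_a$; it is periodic and written $v^\infty=\cdots vvv\cdots$ with $v$ a primitive word (not a proper power), determined up to conjugacy (cyclic rotation). Trajectories are distinct if their codings $v^\infty$ are distinct up to shift, i.e. the corresponding primitive words are not conjugate. *)

theory Defs
  imports "HOL-Analysis.Analysis"
begin

section \<open>Discrete interval exchange transformations\<close>

text \<open>
  The alphabet is a finite type, so its number of letters is \<open>CARD('a)\<close>. The orders
  \<open><\<^sub>D\<close> and \<open><\<^sub>A\<close> are given as strict relations \<open>D\<close> and \<open>A\<close>.
\<close>

definition left_end :: "'a::finite rel \<Rightarrow> ('a \<Rightarrow> nat) \<Rightarrow> 'a \<Rightarrow> nat" where
  "left_end R lam a = (\<Sum>b | (b, a) \<in> R. lam b)"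

text \<open>
  Consecutive intervals of lengths \<open>lam a\<close>, starting at \<open>1\<close> and placed from left to right
  in increasing order of \<open>a\<close> with respect to \<open>R\<close>. So \<open>block D lam a\<close> is \<open>I\<^sub>a\<close>, and
  \<open>block A lam a\<close> is the place of \<open>T(I\<^sub>a)\<close>.
\<close>

definition block :: "'a::finite rel \<Rightarrow> ('a \<Rightarrow> nat) \<Rightarrow> 'a \<Rightarrow> nat set" where
  "block R lam a = {left_end R lam a <.. left_end R lam a + lam a}"

definition total_interval :: "('a::finite \<Rightarrow> nat) \<Rightarrow> nat set" where
  "total_interval lam = {1..sum lam UNIV}"

text \<open>Only the values of \<open>T\<close> on \<open>total_interval lam\<close> matter.\<close>

definition discrete_iet ::
  "'a::finite rel \<Rightarrow> 'a rel \<Rightarrow> ('a \<Rightarrow> nat) \<Rightarrow> (nat \<Rightarrow> nat) \<Rightarrow> bool" where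
  "discrete_iet D A lam T \<longleftrightarrow>
     sum lam UNIV \<ge> 1 \<and>
     bij_betw T (total_interval lam) (total_interval lam) \<and>
     (\<forall>a. T ` block D lam a = block A lam a) \<and>
     (\<forall>a. \<exists>c::int. \<forall>x\<in>block D lam a. int (T x) = int x + c)"

definition symmetric_pair :: "'a rel \<Rightarrow> 'a rel \<Rightarrow> bool" where
  "symmetric_pair D A \<longleftrightarrow> (\<forall>a b. (a, b) \<in> D \<longleftrightarrow> (b, a) \<in> A)"

definition Omega :: "'a::finite rel \<Rightarrow> 'a rel \<Rightarrow> real^'a^'a" where
  "Omega D A = (\<chi> i j.
     if (j, i) \<in> A \<and> (i, j) \<in> D then 1
     else if (j, i) \<in> D \<and> (i, j) \<in> A then -1
     else 0)"


section \<open>Trajectories\<close>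

definition int_iterate :: "'b set \<Rightarrow> ('b \<Rightarrow> 'b) \<Rightarrow> int \<Rightarrow> 'b \<Rightarrow> 'b" where
  "int_iterate S f n x =
     (if n \<ge> 0 then (f ^^ nat n) x else (inv_into S f ^^ nat (- n)) x)"

definition natural_coding ::
  "'a::finite rel \<Rightarrow> ('a \<Rightarrow> nat) \<Rightarrow> (nat \<Rightarrow> nat) \<Rightarrow> nat \<Rightarrow> int \<Rightarrow> 'a" where
  "natural_coding D lam T x n =
     (THE a. int_iterate (total_interval lam) T n x \<in> block D lam a)"

definition shift_rel :: "(int \<Rightarrow> 'a) rel" where
  "shift_rel = {(u, w). \<exists>p. \<forall>n. w n = u (n + p)}"

text \<open>
  The trajectories up to distinctness: two of them are identified iff their bi-infinite
  codings agree up to a shift, even if they come from different orbits of \<open>T\<close>.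
\<close>

definition distinct_trajectories ::
  "'a::finite rel \<Rightarrow> ('a \<Rightarrow> nat) \<Rightarrow> (nat \<Rightarrow> nat) \<Rightarrow> (int \<Rightarrow> 'a) set set" where
  "distinct_trajectories D lam T =
     (natural_coding D lam T ` total_interval lam) // shift_rel"


section \<open>Basic facts\<close>

lemma left_end_step:
  assumes "strict_linear_order R" "(a, b) \<in> R"
  shows "left_end R lam a + lam a \<le> left_end R lam b"
proof -
  have irr: "(a, a) \<notin> R" and tr: "trans R"
    using assms by (auto simp: strict_linear_order_on_def irrefl_def)
  have "left_end R lam a + lam a = sum lam (insert a {c. (c, a) \<in> R})"
    using irr by (simp add: left_end_def)
  also have "\<dots> \<le> sum lam {c. (c, b) \<in> R}"
    using assms(2) tr by (intro sum_mono2) (auto dest: transD)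
  finally show ?thesis by (simp add: left_end_def)
qed

lemma block_less:
  assumes "strict_linear_order R" "(a, b) \<in> R" "x \<in> block R lam a" "y \<in> block R lam b"
  shows "x < y"
  using left_end_step[OF assms(1,2), of lam] assms(3,4) by (auto simp: block_def)

lemma block_disjoint:
  assumes "strict_linear_order R" "a \<noteq> b"
  shows "block R lam a \<inter> block R lam b = {}"
proof -
  have "(a, b) \<in> R \<or> (b, a) \<in> R"
    using assms by (auto simp: strict_linear_order_on_def total_on_def)
  then show ?thesis
    using block_less[OF assms(1)] by (metis disjoint_iff less_irrefl)
qed

lemma card_block [simp]: "card (block R lam a) = lam a"
  by (simp add: block_def)

lemma UN_block:
  assumes "strict_linear_order R"
  shows "(\<Union>a. block R lam a) = total_interval lam"
proof (rule card_subset_eq)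
  show "finite (total_interval lam)" by (simp add: total_interval_def)
  have "left_end R lam a + lam a \<le> sum lam UNIV" for a
  proof -
    have "(a, a) \<notin> R"
      using assms by (auto simp: strict_linear_order_on_def irrefl_def)
    then have "left_end R lam a + lam a = sum lam (insert a {c. (c, a) \<in> R})"
      by (simp add: left_end_def)
    also have "\<dots> \<le> sum lam UNIV" by (intro sum_mono2) auto
    finally show ?thesis .
  qed
  then show "(\<Union>a. block R lam a) \<subseteq> total_interval lam"
    by (force simp: block_def total_interval_def intro: order_trans)
  have "card (\<Union>a. block R lam a) = (\<Sum>a\<in>UNIV. card (block R lam a))"
    using block_disjoint[OF assms] by (intro card_UN_disjoint) (auto simp: block_def)
  then show "card (\<Union>a. block R lam a) = card (total_interval lam)"
    by (simp add: total_interval_def)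
qed

lemma ex1_block:
  assumes "strict_linear_order R" "x \<in> total_interval lam"
  shows "\<exists>!a. x \<in> block R lam a"
  using UN_block[OF assms(1), of lam] block_disjoint[OF assms(1), of _ _ lam] assms(2)
  by (metis UN_E disjoint_iff)

lemma equiv_shift_rel: "equiv UNIV (shift_rel :: (int \<Rightarrow> 'a) rel)"
proof (rule equivI)
  show "refl (shift_rel :: (int \<Rightarrow> 'a) rel)"
    by (rule refl_onI) (auto simp: shift_rel_def intro: exI[of _ 0])
  show "sym (shift_rel :: (int \<Rightarrow> 'a) rel)"
  proof (rule symI)
    fix u w :: "int \<Rightarrow> 'a" assume "(u, w) \<in> shift_rel"
    then obtain p where "\<forall>n. w n = u (n + p)" by (auto simp: shift_rel_def)
    then have "\<forall>n. u n = w (n + (- p))" by simp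
    then show "(w, u) \<in> shift_rel" unfolding shift_rel_def by blast
  qed
  show "trans (shift_rel :: (int \<Rightarrow> 'a) rel)"
  proof (rule transI)
    fix u v w :: "int \<Rightarrow> 'a" assume "(u, v) \<in> shift_rel" "(v, w) \<in> shift_rel"
    then obtain p q where "\<forall>n. v n = u (n + p)" "\<forall>n. w n = v (n + q)"
      unfolding shift_rel_def by blast
    then have "\<forall>n. w n = u (n + (q + p))" by (simp add: add.assoc)
    then show "(u, w) \<in> shift_rel" unfolding shift_rel_def by blast
  qed
qed simp

lemma finite_distinct_trajectories: "finite (distinct_trajectories D lam T)"
  by (simp add: distinct_trajectories_def quotient_def total_interval_def)

lemma discrete_iet_exists:
  assumes D: "strict_linear_order D" and A: "strict_linear_order A" and "sum lam UNIV \<ge> 1"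
  shows "\<exists>T. discrete_iet D A lam T"
proof -
  define letter where "letter x = (THE a. x \<in> block D lam a)" for x
  define T where "T x = x - left_end D lam (letter x) + left_end A lam (letter x)" for x
  have letter: "letter x = a" if "x \<in> block D lam a" for x a
    unfolding letter_def using that block_disjoint[OF D] by (intro the_equality) blast+
  have T: "T x = x - left_end D lam a + left_end A lam a" if "x \<in> block D lam a" for x a
    using letter[OF that] by (simp add: T_def)
  have img: "T ` block D lam a = block A lam a" for a
  proof
    show "T ` block D lam a \<subseteq> block A lam a"
      using T[of _ a] by (auto simp: block_def)
    show "block A lam a \<subseteq> T ` block D lam a"
    proof
      fix y assume y: "y \<in> block A lam a"
      let ?x = "y - left_end A lam a + left_end D lam a"
      have "?x \<in> block D lam a" using y by (auto simp: block_def)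
      moreover from T[OF this] have "T ?x = y" using y by (auto simp: block_def)
      ultimately show "y \<in> T ` block D lam a" by (metis imageI)
    qed
  qed
  have im: "T ` total_interval lam = total_interval lam"
    unfolding UN_block[OF D, symmetric] image_UN img
    by (simp add: UN_block[OF D] UN_block[OF A])
  have "bij_betw T (total_interval lam) (total_interval lam)"
    unfolding bij_betw_def using im
    by (auto intro!: eq_card_imp_inj_on simp: total_interval_def)
  moreover have "\<exists>c::int. \<forall>x\<in>block D lam a. int (T x) = int x + c" for a
    using T[of _ a]
    by (intro exI[of _ "int (left_end A lam a) - int (left_end D lam a)"])
       (auto simp: block_def of_nat_diff)
  ultimately show ?thesis
    unfolding discrete_iet_def using img assms(3) by blast
qed

end

theory Submission
  imports Defs
begin

text \<open>
  Give every point of the interval a real weight that depends only on the trajectory of the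
  point. These weights form a vector space \<open>W\<close> whose dimension is the number of distinct
  trajectories. Adding up the weights in each block \<open>I\<^sub>a\<close> maps \<open>W\<close> linearly into \<open>\<real>\<^sup>k\<close>, and the
  bound comes from two properties of this map \<open>V\<close>.

  The image is isotropic for \<open>\<Omega>\<close>. Let \<open>F x\<close> be the weight of \<open>{1..x}\<close> for \<open>c \<in> W\<close>. Since \<open>T\<close>
  preserves the weight and permutes blocks by translations, \<open>F (T x) - F x\<close> is the entry of
  \<open>\<Omega> (V c)\<close> at the letter of \<open>x\<close> (\<open>cumulative_weight_step\<close>). Pairing with \<open>V c'\<close> gives the sum of
  \<open>c' x (F (T x) - F x)\<close> over all points, which is zero by invariance of \<open>c'\<close>
  (\<open>block_sums_isotropic\<close>).

  The map is injective. If \<open>V c = 0\<close>, then \<open>F\<close> is \<open>T\<close>-invariant and vanishes at the end of every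
  block, and a maximum principle forces \<open>F = 0\<close> (\<open>cumulative_weight_nonpos\<close>), hence \<open>c = 0\<close>.

  An isotropic subspace \<open>U\<close> of \<open>\<real>\<^sup>k\<close> satisfies \<open>2 dim U \<le> k + dim ker \<Omega>\<close>
  (\<open>isotropic_subspace_dim_le\<close>). For a symmetric pair of orders the kernel has dimension at
  most one (\<open>dim_kernel_Omega_symmetric_le_1\<close>).
\<close>


section \<open>Isotropic families of vectors\<close>

text \<open>
  Applied below to block sums indexed by trajectories: injectivity on the index set is needed
  as well, because it is the trajectories that are counted and not their vectors.
\<close>

lemma independent_family:
  fixes v :: "'b \<Rightarrow> 'c::real_vector"
  assumes "finite Q"
    and zero: "\<And>u q. (\<Sum>q\<in>Q. u q *\<^sub>R v q) = 0 \<Longrightarrow> q \<in> Q \<Longrightarrow> u q = 0"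
  shows "inj_on v Q" and "independent (v ` Q)"
proof -
  show inj: "inj_on v Q"
  proof (rule inj_onI, rule ccontr)
    fix p q assume pq: "p \<in> Q" "q \<in> Q" "v p = v q" "p \<noteq> q"
    define u :: "'b \<Rightarrow> real" where "u r = (if r = p then 1 else 0) - (if r = q then 1 else 0)" for r
    have "(\<Sum>r\<in>Q. u r *\<^sub>R v r)
        = (\<Sum>r\<in>Q. if r = p then v r else 0) - (\<Sum>r\<in>Q. if r = q then v r else 0)"
      unfolding sum_subtractf[symmetric] by (rule sum.cong) (auto simp: u_def)
    also have "\<dots> = 0"
      using pq \<open>finite Q\<close> by simp
    finally have "u p = 0" using pq(1) by (rule zero)
    then show False using pq(4) by (simp add: u_def)
  qed
  show "independent (v ` Q)"
  proof (rule independent_if_scalars_zero)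
    show "finite (v ` Q)" using \<open>finite Q\<close> by simp
    fix f x assume "(\<Sum>x\<in>v ` Q. f x *\<^sub>R x) = 0" "x \<in> v ` Q"
    then obtain q where "(\<Sum>q\<in>Q. f (v q) *\<^sub>R v q) = 0" "q \<in> Q" "x = v q"
      by (auto simp: sum.reindex[OF inj])
    then show "f x = 0" using zero[of "\<lambda>q. f (v q)" q] by simp
  qed
qed

text \<open>
  If a subspace \<open>U\<close> is isotropic, then \<open>M\<close> sends it into its orthogonal complement, of
  dimension \<open>n - dim U\<close>, while at most \<open>dim ker M\<close> dimensions of \<open>U\<close> are lost on the way.
\<close>

lemma isotropic_subspace_dim_le:
  fixes M :: "real^'n^'n"
  assumes U: "subspace U"
    and iso: "\<And>x y. x \<in> U \<Longrightarrow> y \<in> U \<Longrightarrow> x \<bullet> (M *v y) = 0"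
  shows "2 * dim U \<le> CARD('n) + dim {v. M *v v = 0}"
proof -
  let ?K = "{v. M *v v = 0}"
  have lin: "linear ((*v) M)" by simp
  have K: "subspace ?K"
    by (rule linear_subspace_kernel[OF lin])
  \<comment> \<open>A complement of the kernel within \<open>U\<close>, on which \<open>M\<close> is injective.\<close>
  define V where "V = {y \<in> U. \<forall>x \<in> U \<inter> ?K. orthogonal x y}"
  have V: "subspace V"
    using U unfolding V_def subspace_def by (auto simp: orthogonal_def inner_add_right)
  have 1: "dim V + dim (U \<inter> ?K) = dim U"
    unfolding V_def by (rule dim_subspace_orthogonal_to_vectors[OF subspace_inter[OF U K] U]) simp
  have "inj_on ((*v) M) V"
  proof (rule inj_onI)
    fix x y assume xy: "x \<in> V" "y \<in> V" "M *v x = M *v y"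
    then have "x - y \<in> V" and "M *v (x - y) = 0"
      using V by (auto simp: subspace_diff matrix_vector_mult_diff_distrib)
    then have "orthogonal (x - y) (x - y)" by (auto simp: V_def)
    then show "x = y" by (simp add: orthogonal_def)
  qed
  then have 2: "dim ((*v) M ` V) = dim V"
    using V lin by (intro dim_image_eq) (auto simp: span_eq_iff[THEN iffD2])
  \<comment> \<open>This is where isotropy enters.\<close>
  have "(*v) M ` V \<subseteq> {y \<in> UNIV. \<forall>x \<in> U. orthogonal x y}"
    using iso by (auto simp: V_def orthogonal_def)
  then have "dim ((*v) M ` V) \<le> dim {y \<in> UNIV. \<forall>x \<in> U. orthogonal x y}"
    by (rule dim_subset)
  moreover have "dim {y \<in> UNIV. \<forall>x \<in> U. orthogonal x y} + dim U = CARD('n)"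
    using dim_subspace_orthogonal_to_vectors[OF U subspace_UNIV] by simp
  moreover have "dim (U \<inter> ?K) \<le> dim ?K" by (intro dim_subset) auto
  ultimately show ?thesis using 1 2 by linarith
qed

lemma isotropic_independent_card_le:
  fixes M :: "real^'n^'n"
  assumes "independent B"
    and iso: "\<And>x y. x \<in> B \<Longrightarrow> y \<in> B \<Longrightarrow> x \<bullet> (M *v y) = 0"
  shows "2 * card B \<le> CARD('n) + dim {v. M *v v = 0}"
proof -
  have lin: "linear (\<lambda>y. x \<bullet> (M *v y))" "linear (\<lambda>x. x \<bullet> (M *v y))" for x y :: "real^'n"
    by (auto intro!: linearI simp: algebra_simps inner_add_left inner_add_right
        matrix_vector_mult_scaleR)
  have 1: "x \<bullet> (M *v y) = 0" if "x \<in> B" "y \<in> span B" for x y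
    using linear_eq_0_on_span[OF lin(1)] iso that by blast
  have "x \<bullet> (M *v y) = 0" if "x \<in> span B" "y \<in> span B" for x y
    using linear_eq_0_on_span[OF lin(2), of B y x] 1 that by blast
  then have "2 * dim (span B) \<le> CARD('n) + dim {v. M *v v = 0}"
    by (rule isotropic_subspace_dim_le[OF subspace_span])
  then show ?thesis
    using assms(1) by (simp add: dim_eq_card_independent)
qed


section \<open>The kernel for a symmetric pair of orders\<close>

lemma Omega_mult_component:
  assumes D: "strict_linear_order D" and A: "strict_linear_order A"
  shows "(Omega D A *v v) $ a = (\<Sum>b | (b, a) \<in> A. v $ b) - (\<Sum>b | (b, a) \<in> D. v $ b)"
proof -
  have "Omega D A $ a $ b = (if (b, a) \<in> A then 1 else 0) - (if (b, a) \<in> D then 1 else 0)" for b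
  proof -
    have "trans D" "trans A" "irrefl D" "irrefl A" "total D" "total A"
      using D A by (auto simp: strict_linear_order_on_def)
    then show ?thesis
      by (cases "a = b") (auto simp: Omega_def irrefl_def total_on_def dest: transD)
  qed
  then have "(Omega D A *v v) $ a
      = (\<Sum>b\<in>UNIV. (if (b, a) \<in> A then v $ b else 0) - (if (b, a) \<in> D then v $ b else 0))"
    by (auto simp: matrix_vector_mult_def intro!: sum.cong)
  then show ?thesis
    by (simp add: sum_subtractf sum.If_cases)
qed

text \<open>
  A kernel vector \<open>v\<close> satisfies \<open>v a = (\<Sum>b. v b) - 2 (\<Sum>b <\<^sub>D a. v b)\<close>, so that its total
  determines its entries one after the other.
\<close>

lemma dim_kernel_Omega_symmetric_le_1:
  fixes D A :: "'a::finite rel"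
  assumes D: "strict_linear_order D" and A: "strict_linear_order A" and sym: "symmetric_pair D A"
  shows "dim {v :: real^'a. Omega D A *v v = 0} \<le> 1"
proof -
  let ?K = "{v :: real^'a. Omega D A *v v = 0}"
  define tot where "tot v = (\<Sum>b\<in>UNIV. v $ b)" for v :: "real^'a"
  have tr: "trans D" and irr: "irrefl D" and total: "total D"
    using D by (auto simp: strict_linear_order_on_def)
  have wf: "wf D"
    using tr irr by (intro finite_acyclic_wf) (auto simp: acyclic_irrefl)
  have K: "subspace ?K"
    by (rule linear_subspace_kernel) simp
  have lin: "linear tot"
    by (auto intro!: linearI simp: tot_def sum.distrib sum_distrib_left)
  have entry: "v $ a + 2 * (\<Sum>b | (b, a) \<in> D. v $ b) = tot v" if "v \<in> ?K" for v a
  proof -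
    have "UNIV = insert a ({b. (b, a) \<in> D} \<union> {b. (b, a) \<in> A})"
      using total sym by (auto simp: total_on_def symmetric_pair_def)
    then have "tot v = sum (($) v) (insert a ({b. (b, a) \<in> D} \<union> {b. (b, a) \<in> A}))"
      by (simp add: tot_def)
    also have "\<dots> = v $ a + sum (($) v) ({b. (b, a) \<in> D} \<union> {b. (b, a) \<in> A})"
      using irr sym by (intro sum.insert) (auto simp: irrefl_def symmetric_pair_def)
    also have "sum (($) v) ({b. (b, a) \<in> D} \<union> {b. (b, a) \<in> A})
        = (\<Sum>b | (b, a) \<in> D. v $ b) + (\<Sum>b | (b, a) \<in> A. v $ b)"
      using irr tr sym by (intro sum.union_disjoint)
        (auto simp: irrefl_def symmetric_pair_def dest: transD)
    finally show ?thesis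
      using Omega_mult_component[OF D A, of v a] that by simp
  qed
  have "v = 0" if v: "v \<in> ?K" and "tot v = 0" for v
  proof -
    have "v $ a = 0" for a
      using wf
    proof (induction a)
      case (less a)
      then have "(\<Sum>b | (b, a) \<in> D. v $ b) = 0" by (intro sum.neutral) auto
      then show ?case using entry[OF v, of a] \<open>tot v = 0\<close> by simp
    qed
    then show ?thesis by (simp add: vec_eq_iff)
  qed
  then have "inj_on tot ?K"
    using linear_inj_on_iff_eq_0[OF lin K] by blast
  then have "dim (tot ` ?K) = dim ?K"
    using K lin by (intro dim_image_eq) (auto simp: span_eq_iff[THEN iffD2])
  moreover have "dim (tot ` ?K) \<le> 1"
    using dim_subset_UNIV[of "tot ` ?K"] by simp
  ultimately show ?thesis by simp
qed


section \<open>Iterates and codings\<close>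

text \<open>
  Used with \<open>h = f\<close>, to see that \<open>T\<close> shifts codings, and with \<open>h = Suc\<close>, to compare the orbits
  of neighbouring points.
\<close>

lemma int_iterate_commute:
  assumes f: "bij_betw f S S" and P: "P \<subseteq> S" "f ` P = P" and h: "h ` P \<subseteq> S"
    and comm: "\<And>y. y \<in> P \<Longrightarrow> f (h y) = h (f y)" and "x \<in> P"
  shows "int_iterate S f n x \<in> P \<and> int_iterate S f n (h x) = h (int_iterate S f n x)"
proof -
  let ?g = "inv_into S f"
  have inj: "inj_on f S" using f by (rule bij_betw_imp_inj_on)
  have fw: "(f ^^ k) x \<in> P \<and> (f ^^ k) (h x) = h ((f ^^ k) x)" for k
    using P(2) comm \<open>x \<in> P\<close> by (induction k) auto
  have back_step: "?g y \<in> P \<and> ?g (h y) = h (?g y)" if y: "y \<in> P" for y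
  proof -
    obtain z where z: "z \<in> P" "y = f z" using P(2) y by blast
    then have "?g y = z" using P(1) inj by auto
    moreover have "?g (h y) = h z"
      using z comm[of z, symmetric] h inj by (auto simp: inv_into_f_f)
    ultimately show ?thesis using z by simp
  qed
  have bw: "(?g ^^ k) x \<in> P \<and> (?g ^^ k) (h x) = h ((?g ^^ k) x)" for k
    using back_step \<open>x \<in> P\<close> by (induction k) auto
  show ?thesis using fw bw by (simp add: int_iterate_def)
qed

lemma int_iterate_succ:
  assumes f: "bij_betw f S S" and "x \<in> S"
  shows "int_iterate S f (n + 1) x = f (int_iterate S f n x)"
proof (cases "n \<ge> 0")
  case True
  then have "nat (n + 1) = Suc (nat n)" by simp
  then show ?thesis using True by (simp add: int_iterate_def)
next
  case False
  let ?g = "inv_into S f"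
  have g: "?g y \<in> S" "f (?g y) = y" if "y \<in> S" for y
    using f that by (auto simp: bij_betw_def inv_into_into f_inv_into_f)
  have S: "(?g ^^ k) x \<in> S" for k
    using g(1) \<open>x \<in> S\<close> by (induction k) auto
  obtain k where k: "n = - int (Suc k)"
    using False by (metis negD not_le)
  then have "int_iterate S f n x = ?g ((?g ^^ k) x)"
    by (simp add: int_iterate_def nat_add_distrib)
  moreover have "int_iterate S f (n + 1) x = (?g ^^ k) x"
    using k by (auto simp: int_iterate_def)
  ultimately show ?thesis using g(2)[OF S] by simp
qed


section \<open>Weights invariant under an interval exchange\<close>

lemma initial_segment_eq_UN_block:
  assumes R: "strict_linear_order R"
  shows "{1..left_end R lam a} = (\<Union>b\<in>{b. (b, a) \<in> R}. block R lam b)"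
proof (intro equalityI subsetI)
  fix y assume y: "y \<in> {1..left_end R lam a}"
  have "left_end R lam a \<le> sum lam UNIV"
    unfolding left_end_def by (intro sum_mono2) auto
  then have "y \<in> total_interval lam" using y by (auto simp: total_interval_def)
  then obtain b where b: "y \<in> block R lam b"
    using ex1_block[OF R] by blast
  have "\<not> (a, b) \<in> R" "b \<noteq> a"
    using left_end_step[OF R, of a b lam] b y by (auto simp: block_def)
  then have "(b, a) \<in> R"
    using R by (auto simp: strict_linear_order_on_def total_on_def)
  then show "y \<in> (\<Union>b\<in>{b. (b, a) \<in> R}. block R lam b)" using b by blast
next
  fix y assume "y \<in> (\<Union>b\<in>{b. (b, a) \<in> R}. block R lam b)"
  then show "y \<in> {1..left_end R lam a}"
    using left_end_step[OF R, of _ a lam] by (force simp: block_def)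
qed

lemma sum_initial_segment:
  fixes c :: "nat \<Rightarrow> real"
  assumes R: "strict_linear_order R" and x: "x \<in> block R lam a"
  shows "sum c {1..x} = (\<Sum>b | (b, a) \<in> R. sum c (block R lam b)) + sum c {left_end R lam a<..x}"
proof -
  have "{1..x} = {1..left_end R lam a} \<union> {left_end R lam a<..x}"
    using x by (auto simp: block_def)
  then have "sum c {1..x} = sum c {1..left_end R lam a} + sum c {left_end R lam a<..x}"
    by (simp add: sum.union_disjoint ivl_disj_int)
  also have "sum c {1..left_end R lam a} = (\<Sum>b | (b, a) \<in> R. sum c (block R lam b))"
    unfolding initial_segment_eq_UN_block[OF R]
    using block_disjoint[OF R] by (intro sum.UNION_disjoint) (auto simp: block_def)
  finally show ?thesis .
qed

locale interval_exchange =
  fixes D A :: "'a::finite rel" and lam :: "'a \<Rightarrow> nat" and T :: "nat \<Rightarrow> nat"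
  assumes D: "strict_linear_order D" and A: "strict_linear_order A"
    and iet: "discrete_iet D A lam T"
begin

abbreviation "I \<equiv> total_interval lam"

abbreviation "coding \<equiv> natural_coding D lam T"

lemma T_bij: "bij_betw T I I" and T_block: "T ` block D lam a = block A lam a"
  using iet by (auto simp: discrete_iet_def)

lemma T_translation:
  assumes "x \<in> block D lam a"
  shows "T x + left_end D lam a = x + left_end A lam a"
proof -
  let ?l = "left_end D lam a" and ?r = "left_end A lam a"
  obtain c :: int where c: "\<And>x. x \<in> block D lam a \<Longrightarrow> int (T x) = int x + c"
    using iet unfolding discrete_iet_def by meson
  \<comment> \<open>The first point of \<open>I\<^sub>a\<close> must go to the first point of \<open>T(I\<^sub>a)\<close>, which determines \<open>c\<close>.\<close>
  have pos: "lam a > 0" using assms by (auto simp: block_def)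
  then have l: "Suc ?l \<in> block D lam a" and "Suc ?r \<in> block A lam a"
    by (auto simp: block_def)
  then obtain z where z: "z \<in> block D lam a" "T z = Suc ?r"
    using T_block[of a] by (metis imageE)
  have "T (Suc ?l) \<in> block A lam a" using l T_block by blast
  then have "T (Suc ?l) \<ge> Suc ?r" by (auto simp: block_def)
  moreover have "z \<ge> Suc ?l" using z(1) by (auto simp: block_def)
  ultimately have "c = int ?r - int ?l"
    using c[OF l] c[OF z(1)] z(2) by linarith
  then show ?thesis using c[OF assms] by linarith
qed

definition invariant :: "(nat \<Rightarrow> real) \<Rightarrow> bool" where
  "invariant c \<longleftrightarrow> (\<forall>x\<in>I. c (T x) = c x)"

definition block_sums :: "(nat \<Rightarrow> real) \<Rightarrow> real^'a" where
  "block_sums c = (\<chi> a. sum c (block D lam a))"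

lemma block_subset: "block D lam a \<subseteq> I"
  using UN_block[OF D] by blast

text \<open>
  The weight to the left of a point consists of the weight of whole blocks and of a part of its
  own block. The translation carries the latter along unchanged, so only the order of the blocks
  matters for the difference; this is what \<open>\<Omega>\<close> records.
\<close>

lemma cumulative_weight_step:
  assumes c: "invariant c" and x: "x \<in> block D lam a"
  shows "sum c {1..T x} - sum c {1..x} = (Omega D A *v block_sums c) $ a"
proof -
  let ?l = "left_end D lam a" and ?r = "left_end A lam a"
  have Tx: "T x \<in> block A lam a" using x T_block by blast
  have inv: "c (T y) = c y" if "y \<in> block D lam b" for y b
    using c block_subset that by (auto simp: invariant_def)
  have blocks: "sum c (block A lam b) = sum c (block D lam b)" for b
  proof -
    have "inj_on T (block D lam b)"
      using T_bij block_subset by (meson bij_betw_imp_inj_on inj_on_subset)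
    then have "sum c (block A lam b) = sum (c \<circ> T) (block D lam b)"
      unfolding T_block[symmetric] by (rule sum.reindex)
    then show ?thesis using inv by (simp cong: sum.cong)
  qed
  have part: "y \<in> block D lam a" if "y \<in> {?l<..x}" for y
    using that x by (auto simp: block_def)
  have "sum c {?l<..x} = sum c {?r<..T x}"
  proof (rule sum.reindex_bij_witness[of _ "\<lambda>y. y + ?l - ?r" T])
    fix y assume y: "y \<in> {?l<..x}"
    note T = T_translation[OF part[OF y]] T_translation[OF x]
    show "T y + ?l - ?r = y" "T y \<in> {?r<..T x}" using T y by auto
    show "c (T y) = c y" using inv part[OF y] .
  next
    fix y assume y: "y \<in> {?r<..T x}"
    then show y': "y + ?l - ?r \<in> {?l<..x}" using T_translation[OF x] by auto
    show "T (y + ?l - ?r) = y" using T_translation[OF part[OF y']] y by auto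
  qed
  then have "sum c {1..T x} - sum c {1..x}
      = (\<Sum>b | (b, a) \<in> A. sum c (block D lam b)) - (\<Sum>b | (b, a) \<in> D. sum c (block D lam b))"
    using sum_initial_segment[OF D x, of c] sum_initial_segment[OF A Tx, of c]
    by (simp add: blocks)
  then show ?thesis
    by (simp add: Omega_mult_component[OF D A] block_sums_def)
qed

text \<open>
  The pairing is the total of \<open>c'\<close> times a coboundary, which vanishes because \<open>T\<close> permutes
  the points and preserves \<open>c'\<close>.
\<close>

lemma block_sums_isotropic:
  assumes c: "invariant c" and c': "invariant c'"
  shows "block_sums c' \<bullet> (Omega D A *v block_sums c) = 0"
proof -
  define F where "F x = sum c {1..x}" for x
  have "block_sums c' \<bullet> (Omega D A *v block_sums c)
      = (\<Sum>a\<in>UNIV. \<Sum>x\<in>block D lam a. c' x * (F (T x) - F x))"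
    unfolding inner_vec_def F_def
    using cumulative_weight_step[OF c]
    by (simp add: block_sums_def sum_distrib_right cong: sum.cong)
  also have "\<dots> = (\<Sum>x\<in>(\<Union>a. block D lam a). c' x * (F (T x) - F x))"
    using block_disjoint[OF D]
    by (intro sum.UNION_disjoint[symmetric]) (auto simp: block_def)
  also have "\<dots> = (\<Sum>x\<in>I. c' x * (F (T x) - F x))"
    by (simp add: UN_block[OF D])
  also have "\<dots> = (\<Sum>x\<in>I. c' (T x) * F (T x)) - (\<Sum>x\<in>I. c' x * F x)"
    using c' by (simp add: invariant_def algebra_simps sum_subtractf cong: sum.cong)
  also have "(\<Sum>x\<in>I. c' (T x) * F (T x)) = (\<Sum>x\<in>I. c' x * F x)"
    by (rule sum.reindex_bij_betw[OF T_bij])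
  finally show ?thesis by simp
qed


section \<open>Weights that depend on the trajectory only\<close>

definition trajectory_weight :: "(nat \<Rightarrow> real) \<Rightarrow> bool" where
  "trajectory_weight c \<longleftrightarrow>
     (\<forall>x\<in>I. \<forall>y\<in>I. (coding x, coding y) \<in> shift_rel \<longrightarrow> c x = c y)"

lemma coding_T:
  assumes "x \<in> I"
  shows "(coding x, coding (T x)) \<in> shift_rel"
proof -
  have "T ` I = I" using T_bij by (rule bij_betw_imp_surj_on)
  then have "int_iterate I T n (T x) = int_iterate I T (n + 1) x" for n
    using int_iterate_commute[OF T_bij, of I T x n] int_iterate_succ[OF T_bij assms] assms
    by auto
  then show ?thesis
    unfolding shift_rel_def natural_coding_def by auto
qed

lemma trajectory_weight_invariant: "trajectory_weight c \<Longrightarrow> invariant c"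
  using coding_T T_bij unfolding trajectory_weight_def invariant_def bij_betw_def
  by (metis imageI)

lemma coding_Suc_eq:
  assumes P: "P \<subseteq> I" "T ` P = P"
    and step: "\<And>y. y \<in> P \<Longrightarrow> \<exists>a. y \<in> block D lam a \<and> Suc y \<in> block D lam a"
    and x: "x \<in> P"
  shows "coding (Suc x) = coding x"
proof
  fix n
  have "T (Suc y) = Suc (T y)" if y: "y \<in> P" for y
  proof -
    obtain a where "y \<in> block D lam a" "Suc y \<in> block D lam a" using step[OF y] by blast
    from this[THEN T_translation] show ?thesis by simp
  qed
  moreover have "Suc ` P \<subseteq> I" using step block_subset by blast
  ultimately have it: "int_iterate I T n x \<in> P"
      "int_iterate I T n (Suc x) = Suc (int_iterate I T n x)"
    using int_iterate_commute[OF T_bij P, of Suc x n] x by auto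
  obtain a where a: "int_iterate I T n x \<in> block D lam a"
      "Suc (int_iterate I T n x) \<in> block D lam a"
    using step[OF it(1)] by blast
  have "(THE b. z \<in> block D lam b) = a" if "z \<in> block D lam a" for z
    using that block_disjoint[OF D] by (intro the_equality) blast+
  then show "coding (Suc x) n = coding x n"
    using a by (simp add: natural_coding_def it(2))
qed

text \<open>
  If all block sums vanish, the cumulative weight \<open>F\<close> is invariant under \<open>T\<close> and is zero at the
  right end of every block. Where \<open>F\<close> attains a positive maximum, \<open>x\<close> and \<open>x + 1\<close> therefore
  stay in a common block forever and have the same coding and the same weight. This weight is
  \<open>\<ge> 0\<close> as the last step up to the maximum and \<open>\<le> 0\<close> as the step after it; hence \<open>F\<close> is still
  maximal at \<open>x + 1\<close>, and there is no rightmost maximum.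
\<close>

lemma cumulative_weight_nonpos:
  assumes c: "trajectory_weight c" and zero: "block_sums c = 0" and x: "x \<in> I"
  shows "sum c {1..x} \<le> 0"
proof (rule ccontr)
  assume pos: "\<not> sum c {1..x} \<le> 0"
  define F where "F y = sum c {1..y}" for y
  define M where "M = Max (F ` I)"
  define P where "P = {y \<in> I. F y = M}"
  have fin: "finite I" by (simp add: total_interval_def)
  have le: "F y \<le> M" if "y \<in> I" for y
    using that fin by (simp add: M_def)
  have M: "M > 0" using pos le[OF x] by (simp add: F_def)
  have "M \<in> F ` I" using fin x unfolding M_def by (intro Max_in) auto
  then have P: "P \<subseteq> I" "finite P" "P \<noteq> {}" using fin by (auto simp: P_def)
  have FT: "F (T y) = F y" if "y \<in> I" for y
  proof -
    obtain a where "y \<in> block D lam a" using ex1_block[OF D \<open>y \<in> I\<close>] by blast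
    then show ?thesis
      using cumulative_weight_step[OF trajectory_weight_invariant[OF c]] zero
      by (simp add: F_def)
  qed
  have "T ` P \<subseteq> P"
    using FT T_bij by (auto simp: P_def bij_betw_def)
  moreover have "inj_on T P"
    using T_bij P(1) by (meson bij_betw_imp_inj_on inj_on_subset)
  ultimately have TP: "T ` P = P" using P(2) by (intro endo_inj_surj)
  have step: "\<exists>a. y \<in> block D lam a \<and> Suc y \<in> block D lam a" if y: "y \<in> P" for y
  proof -
    obtain a where a: "y \<in> block D lam a" using ex1_block[OF D] y P(1) by blast
    let ?e = "left_end D lam a + lam a"
    have sums: "sum c (block D lam b) = 0" for b
      using zero by (simp add: block_sums_def vec_eq_iff)
    have "?e \<in> block D lam a" using a by (auto simp: block_def)
    \<comment> \<open>Up to the right end of a block there are only whole blocks.\<close>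
    from sum_initial_segment[OF D this, of c] have "F ?e = 0"
      using sums[of a, unfolded block_def] by (simp add: F_def sums)
    then have "y \<noteq> ?e" using y M by (auto simp: P_def)
    then have "Suc y \<in> block D lam a" using a by (auto simp: block_def)
    then show ?thesis using a by blast
  qed
  define z where "z = Max P"
  have z: "z \<in> P" using P(2,3) by (simp add: z_def)
  have Suc_z: "Suc z \<in> I" using step[OF z] block_subset by blast
  have "coding (Suc z) = coding z"
    using coding_Suc_eq[OF P(1) TP step z] .
  then have same: "c (Suc z) = c z"
    using c Suc_z z P(1) equivE[OF equiv_shift_rel] unfolding trajectory_weight_def
    by (metis UNIV_I refl_onD subsetD)
  have F_Suc: "F (Suc y) = F y + c (Suc y)" for y by (simp add: F_def)
  obtain w where w: "z = Suc w"
    using z P(1) by (cases z) (auto simp: total_interval_def)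
  have "F w \<le> M"
  proof (cases w)
    case 0
    then show ?thesis using M by (simp add: F_def)
  next
    case (Suc v)
    then have "w \<in> I" using z P(1) w by (auto simp: total_interval_def)
    then show ?thesis by (rule le)
  qed
  then have "c z \<ge> 0" using F_Suc[of w] z w by (simp add: P_def)
  then have eq: "F (Suc z) = M"
    using F_Suc[of z] le[OF Suc_z] same z by (simp add: P_def)
  have "Suc z \<in> P" using Suc_z eq by (simp add: P_def)
  then have "Suc z \<le> z" using P(2) by (simp add: z_def)
  then show False by simp
qed

lemma trajectory_weight_eq_0:
  assumes c: "trajectory_weight c" and zero: "block_sums c = 0" and x: "x \<in> I"
  shows "c x = 0"
proof -
  have neg: "trajectory_weight (\<lambda>x. - c x)" "block_sums (\<lambda>x. - c x) = 0"
    using c zero by (simp_all add: trajectory_weight_def block_sums_def sum_negf vec_eq_iff)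
  have F: "sum c {1..y} = 0" if "y \<in> I" for y
    using cumulative_weight_nonpos[OF c zero that] cumulative_weight_nonpos[OF neg that]
    by (simp add: sum_negf)
  obtain w where w: "x = Suc w"
    using x by (cases x) (auto simp: total_interval_def)
  have "sum c {1..w} = 0"
    using F[of w] x w by (cases w) (auto simp: total_interval_def)
  then show ?thesis using F[OF x] w by simp
qed

text \<open>
  A basis of the weights are the indicator functions of the trajectory classes. Their block
  sums, which count the letters in all orbits with a given coding, are the isotropic family.
\<close>

lemma card_distinct_trajectories_le:
  "2 * card (distinct_trajectories D lam T) \<le> CARD('a) + dim {v. Omega D A *v v = 0}"
proof -
  let ?Q = "distinct_trajectories D lam T"
  define ind :: "(int \<Rightarrow> 'a) set \<Rightarrow> nat \<Rightarrow> real" where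
    "ind q x = (if coding x \<in> q then 1 else 0)" for q x
  have is_class: "q \<in> UNIV // shift_rel" if "q \<in> ?Q" for q
    using that by (auto simp: distinct_trajectories_def quotient_def)
  have same_class: "u \<in> q \<longleftrightarrow> w \<in> q" if "q \<in> ?Q" "(u, w) \<in> shift_rel" for q u w
    using in_quotient_imp_closed[OF equiv_shift_rel is_class[OF that(1)]] that(2)
      equivE[OF equiv_shift_rel] by (metis symD)
  have comb: "trajectory_weight (\<lambda>x. \<Sum>q\<in>?Q. u q * ind q x)" for u
    unfolding trajectory_weight_def ind_def using same_class
    by (auto intro!: sum.cong)
  have ind: "invariant (ind q)" if "q \<in> ?Q" for q
    using same_class[OF that]
    by (intro trajectory_weight_invariant) (auto simp: trajectory_weight_def ind_def)
  have zero: "u q = 0" if sum0: "(\<Sum>q\<in>?Q. u q *\<^sub>R block_sums (ind q)) = 0" and q: "q \<in> ?Q" for u q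
  proof -
    obtain x where x: "x \<in> I" "q = shift_rel `` {coding x}"
      using q by (auto simp: distinct_trajectories_def quotient_def)
    then have xq: "coding x \<in> q"
      using equiv_class_self[OF equiv_shift_rel] by blast
    have "block_sums (\<lambda>x. \<Sum>q\<in>?Q. u q * ind q x) = (\<Sum>q\<in>?Q. u q *\<^sub>R block_sums (ind q))"
      by (simp add: vec_eq_iff block_sums_def sum_distrib_left sum.swap[of _ ?Q])
    then have "(\<Sum>q\<in>?Q. u q * ind q x) = 0"
      using trajectory_weight_eq_0[OF comb _ x(1)] sum0 by simp
    \<comment> \<open>Distinct classes are disjoint, so \<open>x\<close> sees only the coefficient of its own class.\<close>
    moreover have "u p * ind p x = (if p = q then u q else 0)" if "p \<in> ?Q" for p
      using quotient_disj[OF equiv_shift_rel is_class[OF that] is_class[OF q]] xq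
      by (auto simp: ind_def)
    ultimately show ?thesis
      using q finite_distinct_trajectories[of D lam T] by (simp cong: sum.cong)
  qed
  have fam: "inj_on (\<lambda>q. block_sums (ind q)) ?Q" "independent ((\<lambda>q. block_sums (ind q)) ` ?Q)"
    by (rule independent_family, rule finite_distinct_trajectories, erule (1) zero)+
  have "2 * card ((\<lambda>q. block_sums (ind q)) ` ?Q) \<le> CARD('a) + dim {v. Omega D A *v v = 0}"
    using fam(2) block_sums_isotropic ind
    by (intro isotropic_independent_card_le) auto
  then show ?thesis using fam(1) by (simp add: card_image)
qed

end

theorem corollary3:
  fixes D A :: "'a::finite rel" and lam :: "'a \<Rightarrow> nat" and T :: "nat \<Rightarrow> nat"
  assumes "strict_linear_order D" and "strict_linear_order A"
    and "discrete_iet D A lam T"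
  shows "(D \<noteq> A \<longrightarrow>
            card (distinct_trajectories D lam T)
              \<le> (CARD('a) + dim {v :: real^'a. Omega D A *v v = 0}) div 2) \<and>
         (symmetric_pair D A \<longrightarrow>
            card (distinct_trajectories D lam T) \<le> (CARD('a) + 1) div 2)"
proof -
  interpret interval_exchange D A lam T
    using assms by unfold_locales
  show ?thesis
    using card_distinct_trajectories_le dim_kernel_Omega_symmetric_le_1[OF assms(1,2)]
    by linarith
qed

end
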